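(* Let $R=\mathbb C[x,y]$ be the homogeneous coordinate ring of $(\mathbb P^1,\mathcal O_{\mathbb P^1}(1))$, and let $A\subset R[t]=\mathbb C[t][x,y]$ be the $\mathbb C[t]$-subalgebra generated by $$t(x+y),\quad txy,\quad txy^2,\quad t^2y.$$ Let $\chi$ be the (finitely generated) filtration $F_iR=\{s\in R: t^is\in A\}$, $i\geq 0$, of $R$, whose Rees algebra is $A$. Let $\lambda:\mathbb C^*\to SL(H^0(\mathbb P^1,\mathcal O_{\mathbb P^1}(1)))$ be the one-parameter subgroup acting by $\lambda(\tau)\cdot x=\tau^{-1}x$, $\lambda(\tau)\cdot y=\tau y$, and let $\bar\chi$ be the limit filtration of $\chi$ under $\lambda$. Then $\bar\chi$ is not finitely generated.
   Context: $R=\bigoplus_kR_k$ is graded by the usual degree in $x,y$. The Rees algebra of a filtration $\{F_iR\}_{i\ge0}$ of $R$ is $\bigoplus_{i\ge0}(F_iR)t^i\subset R[t]$, and a filtration is called finitely generated if its Rees algebra is a finitely generated algebra. The one-parameter subgroup $\lambda$ acts on $R$ by algebra automorphisms. The limit (specialisation) $\bar\chi$ of $\chi$ under $\lambda$ is the filtration with $\bar F_iR_k=\lim_{\tau\to0}\lambda(\tau)\cdot(F_iR\cap R_k)$, the limit being taken in the Grassmannian of subspaces of $R_k$, and $\bar F_iR=\bigoplus_k\bar F_iR_k$. Equivalently, $\bar F_iR_k$ is spanned by the lowest $\lambda$-weight terms of the elements of $F_iR\cap R_k$. *)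

theory Defs
  imports "HOL-Analysis.Analysis" "HOL-Computational_Algebra.Polynomial"
begin

section \<open>The graded ring \<open>R = \<complex>[x,y]\<close>\<close>

text \<open>
  \<open>\<complex>[x,y]\<close> is represented as \<open>\<complex>[x][y]\<close>: the coefficient of \<open>x\<^sup>i y\<^sup>j\<close> in \<open>p\<close> is
  \<open>coeff (coeff p j) i\<close>. The ring \<open>R[t]\<close> is \<^typ>\<open>complex poly poly poly\<close>, with \<open>t\<close> outermost.
\<close>

type_synonym bipoly = "complex poly poly"

definition var_x :: bipoly where "var_x = [:[:0, 1:]:]"
definition var_y :: bipoly where "var_y = [:0, 1:]"

definition cscale :: "complex \<Rightarrow> bipoly \<Rightarrow> bipoly" where
  "cscale c p = smult [:c:] p"

global_interpretation bipoly: vector_space cscale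
  by unfold_locales
    (simp_all add: cscale_def smult_add_right smult_add_left[symmetric] mult.commute
      flip: one_pCons)

definition homog :: "nat \<Rightarrow> bipoly set" where
  "homog k = {p. \<forall>i j. coeff (coeff p j) i \<noteq> 0 \<longrightarrow> i + j = k}"


section \<open>Finitely generated filtrations\<close>

definition is_subring :: "'a::comm_ring_1 set \<Rightarrow> bool" where
  "is_subring B \<longleftrightarrow> 1 \<in> B \<and> (\<forall>a\<in>B. \<forall>b\<in>B. a - b \<in> B \<and> a * b \<in> B)"

text \<open>
  When \<open>K\<close> is a subring, \<open>adjoin K S\<close> is the \<open>K\<close>-subalgebra generated by \<open>S\<close>.
\<close>

definition adjoin :: "'a::comm_ring_1 set \<Rightarrow> 'a set \<Rightarrow> 'a set" where
  "adjoin K S = is_subring hull (K \<union> S)"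

definition scalars :: "bipoly poly set" where
  "scalars = range (\<lambda>c. [:[:[:c:]:]:])"

definition scalars_t :: "bipoly poly set" where
  "scalars_t = range (map_poly (\<lambda>c. [:[:c:]:]))"

text \<open>\<open>\<Oplus>\<^sub>i F\<^sub>i t\<^sup>i\<close>, for a filtration by additive subgroups.\<close>

definition rees :: "(nat \<Rightarrow> bipoly set) \<Rightarrow> bipoly poly set" where
  "rees F = {p. \<forall>i. coeff p i \<in> F i}"

definition finitely_generated :: "(nat \<Rightarrow> bipoly set) \<Rightarrow> bool" where
  "finitely_generated F \<longleftrightarrow> (\<exists>S. finite S \<and> rees F = adjoin scalars S)"


section \<open>Grassmannians of subspaces of \<open>R\<^sub>k\<close>\<close>

text \<open>
  The topology of coefficientwise convergence; on each finite-dimensional \<open>R\<^sub>k\<close> it is the usual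
  topology of a complex vector space.
\<close>

definition coeff_topology :: "bipoly topology" where
  "coeff_topology = pullback_topology UNIV (\<lambda>p (i, j). coeff (coeff p j) i) euclidean"

definition stiefel :: "nat \<Rightarrow> nat \<Rightarrow> (nat \<Rightarrow> bipoly) topology" where
  "stiefel k d = subtopology (product_topology (\<lambda>_. coeff_topology) {..<d})
     {v. v ` {..<d} \<subseteq> homog k \<and> inj_on v {..<d} \<and> bipoly.independent (v ` {..<d})}"

text \<open>
  \<open>Gr(d, R\<^sub>k)\<close> carries the quotient topology along the map sending a \<open>d\<close>-frame to its span.
\<close>

definition grassmannian :: "nat \<Rightarrow> nat \<Rightarrow> bipoly set topology" where
  "grassmannian k d = topology (\<lambda>U.
     U \<subseteq> {W. bipoly.subspace W \<and> W \<subseteq> homog k \<and> bipoly.dim W = d} \<and>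
     openin (stiefel k d) {v \<in> topspace (stiefel k d). bipoly.span (v ` {..<d}) \<in> U})"

lemma openin_grassmannian:
  "openin (grassmannian k d) U \<longleftrightarrow>
     U \<subseteq> {W. bipoly.subspace W \<and> W \<subseteq> homog k \<and> bipoly.dim W = d} \<and>
     openin (stiefel k d) {v \<in> topspace (stiefel k d). bipoly.span (v ` {..<d}) \<in> U}"
proof -
  let ?G = "{W. bipoly.subspace W \<and> W \<subseteq> homog k \<and> bipoly.dim W = d}"
  let ?pre = "\<lambda>U. {v \<in> topspace (stiefel k d). bipoly.span (v ` {..<d}) \<in> U}"
  have "istopology (\<lambda>U. U \<subseteq> ?G \<and> openin (stiefel k d) (?pre U))"
    unfolding istopology_def
  proof (intro conjI allI impI)
    fix S T assume "S \<subseteq> ?G \<and> openin (stiefel k d) (?pre S)"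
      and "T \<subseteq> ?G \<and> openin (stiefel k d) (?pre T)"
    moreover have "?pre (S \<inter> T) = ?pre S \<inter> ?pre T" by auto
    ultimately show "S \<inter> T \<subseteq> ?G" "openin (stiefel k d) (?pre (S \<inter> T))"
      by (auto intro: openin_Int)
  next
    fix \<U> assume *: "\<forall>U\<in>\<U>. U \<subseteq> ?G \<and> openin (stiefel k d) (?pre U)"
    then show "\<Union>\<U> \<subseteq> ?G" by blast
    have "?pre (\<Union>\<U>) = (\<Union>U\<in>\<U>. ?pre U)" by auto
    then show "openin (stiefel k d) (?pre (\<Union>\<U>))" using * by auto
  qed
  then show ?thesis
    by (simp add: grassmannian_def topology_inverse')
qed

lemma topspace_grassmannian:
  "topspace (grassmannian k d) = {W. bipoly.subspace W \<and> W \<subseteq> homog k \<and> bipoly.dim W = d}"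
    (is "_ = ?G")
proof
  show "topspace (grassmannian k d) \<subseteq> ?G"
    using openin_topspace[of "grassmannian k d"] by (simp only: openin_grassmannian)
  have hom: "bipoly.subspace (homog k)"
    by (rule bipoly.subspaceI) (auto simp: homog_def cscale_def, metis add_0)
  have "bipoly.span (v ` {..<d}) \<in> ?G" if "v \<in> topspace (stiefel k d)" for v
  proof -
    from that have v: "v ` {..<d} \<subseteq> homog k" "inj_on v {..<d}"
        "bipoly.independent (v ` {..<d})"
      by (auto simp: stiefel_def)
    then show ?thesis
      using bipoly.span_minimal[OF v(1) hom]
      by (simp add: bipoly.dim_eq_card_independent card_image)
  qed
  then have "{v \<in> topspace (stiefel k d). bipoly.span (v ` {..<d}) \<in> ?G} = topspace (stiefel k d)"
    by blast
  then have "openin (grassmannian k d) ?G"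
    by (simp add: openin_grassmannian)
  then show "?G \<subseteq> topspace (grassmannian k d)"
    by (rule openin_subset)
qed


section \<open>The one-parameter subgroup and the limit filtration\<close>

text \<open>The substitution \<open>p(x, y) \<mapsto> p(\<tau>\<^sup>-\<^sup>1 x, \<tau> y)\<close>.\<close>

definition lam :: "complex \<Rightarrow> bipoly \<Rightarrow> bipoly" where
  "lam \<tau> p = pcompose (map_poly (\<lambda>c. pcompose c [:0, inverse \<tau>:]) p) [:0, [:\<tau>:]:]"

lemma coeff_lam: "coeff (coeff (lam \<tau> p) j) i = inverse \<tau> ^ i * \<tau> ^ j * coeff (coeff p j) i"
proof -
  have *: "[:0, c:] = smult c [:0, 1:]" "[:0, c:] = monom c 1" for c :: "'a::comm_ring_1"
    by (simp_all add: monom_altdef)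
  have "[:\<tau>:] ^ j = [:\<tau> ^ j:]" by (induction j) simp_all
  then show ?thesis
    by (simp add: lam_def *(2) coeff_map_poly)
qed

lemma bipoly_eqI: "(\<And>i j. coeff (coeff p j) i = coeff (coeff q j) i) \<Longrightarrow> p = (q :: bipoly)"
  by (simp add: poly_eq_iff)

lemma lam_x: "lam \<tau> var_x = cscale (inverse \<tau>) var_x"
  and lam_y: "lam \<tau> var_y = cscale \<tau> var_y"
  and lam_1: "lam \<tau> 1 = 1"
  by (simp_all add: lam_def var_x_def var_y_def cscale_def map_poly_pCons pcompose_pCons
      map_poly_1' pcompose_1)

lemma lam_add: "lam \<tau> (p + q) = lam \<tau> p + lam \<tau> q"
  and lam_cscale: "lam \<tau> (cscale c p) = cscale c (lam \<tau> p)"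
  by (rule bipoly_eqI, simp add: coeff_lam cscale_def algebra_simps)+

lemma lam_mult: "lam \<tau> (p * q) = lam \<tau> p * lam \<tau> q"
proof -
  have "map_poly (\<lambda>c. pcompose c r) (p * q) =
      map_poly (\<lambda>c. pcompose c r) p * map_poly (\<lambda>c. pcompose c r) q" for r :: "complex poly"
    by (simp add: poly_eq_iff coeff_map_poly coeff_mult pcompose_sum pcompose_mult)
  then show ?thesis
    by (simp add: lam_def pcompose_mult)
qed

text \<open>
  \<open>\<Oplus>\<^sub>k L\<^sub>k\<close>, where \<open>L\<^sub>k\<close> is the limit of \<open>\<rho> \<tau> \<cdot> (F\<^sub>i \<inter> R\<^sub>k)\<close> in the Grassmannian as \<open>\<tau>\<close> tends to \<open>0\<close>
  through nonzero complex numbers.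
\<close>

definition lim_filtration :: "(complex \<Rightarrow> bipoly \<Rightarrow> bipoly) \<Rightarrow> (nat \<Rightarrow> bipoly set) \<Rightarrow> nat \<Rightarrow> bipoly set" where
  "lim_filtration \<rho> F i = bipoly.span (\<Union>k. THE L.
     limitin (grassmannian k (bipoly.dim (F i \<inter> homog k))) (\<lambda>\<tau>. \<rho> \<tau> ` (F i \<inter> homog k)) L (at 0))"


section \<open>The algebra \<open>A\<close> and its filtration\<close>

definition alg_A :: "bipoly poly set" where
  "alg_A = adjoin scalars_t
     {monom (var_x + var_y) 1, monom (var_x * var_y) 1, monom (var_x * var_y\<^sup>2) 1, monom var_y 2}"

definition chi :: "nat \<Rightarrow> bipoly set" where
  "chi i = {s. monom s i \<in> alg_A}"

lemma is_subring_adjoin: "is_subring (adjoin K S)"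
  unfolding adjoin_def by (rule hull_in) (auto simp: is_subring_def)

lemma adjoin_superset: "K \<union> S \<subseteq> adjoin K S"
  unfolding adjoin_def by (rule hull_subset)

lemma adjoin_minimal: "K \<union> S \<subseteq> B \<Longrightarrow> is_subring B \<Longrightarrow> adjoin K S \<subseteq> B"
  unfolding adjoin_def by (rule hull_minimal)

lemma is_subring_simps:
  assumes "is_subring B"
  shows "1 \<in> B" "0 \<in> B" "a \<in> B \<Longrightarrow> b \<in> B \<Longrightarrow> a + b \<in> B" "a \<in> B \<Longrightarrow> b \<in> B \<Longrightarrow> a * b \<in> B"
    "a \<in> B \<Longrightarrow> b \<in> B \<Longrightarrow> a - b \<in> B"
proof -
  show 1: "1 \<in> B" and d: "\<And>a b. a \<in> B \<Longrightarrow> b \<in> B \<Longrightarrow> a - b \<in> B"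
    and "a \<in> B \<Longrightarrow> b \<in> B \<Longrightarrow> a * b \<in> B"
    using assms by (auto simp: is_subring_def)
  show 0: "0 \<in> B" using d[OF 1 1] by simp
  show "a + b \<in> B" if "a \<in> B" "b \<in> B"
    using d[OF that(1) d[OF 0 that(2)]] by simp
qed

lemma is_subring_sum: "is_subring B \<Longrightarrow> (\<And>i. i \<in> I \<Longrightarrow> f i \<in> B) \<Longrightarrow> sum f I \<in> B"
  by (induction I rule: infinite_finite_induct) (simp_all add: is_subring_simps(2,3))

lemma monom_sum: "monom (sum f I) n = (\<Sum>i\<in>I. monom (f i) n)"
  by (induction I rule: infinite_finite_induct) (simp_all flip: add_monom)

lemma alg_A_graded: "p \<in> alg_A \<Longrightarrow> monom (coeff p i) i \<in> alg_A"
proof -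
  let ?B = "{p. \<forall>i. monom (coeff p i) i \<in> alg_A}"
  have A: "is_subring alg_A" by (simp add: alg_A_def is_subring_adjoin)
  let ?S = "{monom (var_x + var_y) 1, monom (var_x * var_y) 1, monom (var_x * var_y\<^sup>2) 1,
    monom var_y 2}"
  have sup: "scalars_t \<union> ?S \<subseteq> alg_A"
    unfolding alg_A_def by (rule adjoin_superset)
  then have sub: "scalars_t \<subseteq> alg_A" by (rule Un_subset_iff[THEN iffD1, THEN conjunct1])
  have "monom (coeff p i) i \<in> alg_A" if "p \<in> scalars_t" for p i
  proof -
    from that obtain q where "p = map_poly (\<lambda>c. [:[:c:]:]) q" by (auto simp: scalars_t_def)
    then have "monom (coeff p i) i = map_poly (\<lambda>c. [:[:c:]:]) (monom (coeff q i) i)"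
      by (simp add: map_poly_monom coeff_map_poly)
    then show ?thesis using sub by (auto simp: scalars_t_def)
  qed
  then have "scalars_t \<subseteq> ?B" by blast
  moreover have "monom (coeff (monom s n) i) i \<in> alg_A" if "monom s n \<in> alg_A" for s n i
    using that is_subring_simps(2)[OF A] by (cases "n = i") simp_all
  then have "?S \<subseteq> ?B" using sup is_subring_simps(2)[OF A] by simp
  moreover have "is_subring ?B"
  proof -
    have "monom (coeff 1 i) i \<in> alg_A" for i
      using is_subring_simps(1,2)[OF A] by (cases "i = 0") (simp_all add: monom_0 one_pCons[symmetric])
    moreover have "monom (coeff (a - b) i) i \<in> alg_A" "monom (coeff (a * b) i) i \<in> alg_A"
      if a: "\<forall>i. monom (coeff a i) i \<in> alg_A" and b: "\<forall>i. monom (coeff b i) i \<in> alg_A" for a b i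
    proof -
      show "monom (coeff (a - b) i) i \<in> alg_A"
        unfolding coeff_diff diff_monom[symmetric] using a b by (intro is_subring_simps(5)[OF A]) blast+
      have "monom (coeff (a * b) i) i =
          (\<Sum>j\<le>i. monom (coeff a j) j * monom (coeff b (i - j)) (i - j))"
        by (simp add: coeff_mult monom_sum mult_monom)
      also have "\<dots> \<in> alg_A"
        using a b by (intro is_subring_sum[OF A] is_subring_simps(4)[OF A]) blast+
      finally show "monom (coeff (a * b) i) i \<in> alg_A" .
    qed
    ultimately show ?thesis
      unfolding is_subring_def by blast
  qed
  ultimately have "adjoin scalars_t ?S \<subseteq> ?B"
    by (intro adjoin_minimal Un_least)
  then show "p \<in> alg_A \<Longrightarrow> monom (coeff p i) i \<in> alg_A"
    unfolding alg_A_def[symmetric] by blast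
qed

lemma rees_chi: "rees chi = alg_A"
proof
  show "alg_A \<subseteq> rees chi"
    using alg_A_graded by (auto simp: rees_def chi_def)
  have A: "is_subring alg_A" by (simp add: alg_A_def is_subring_adjoin)
  show "rees chi \<subseteq> alg_A"
  proof
    fix p assume "p \<in> rees chi"
    then have "(\<Sum>i\<le>degree p. monom (coeff p i) i) \<in> alg_A"
      by (auto simp: rees_def chi_def intro: is_subring_sum[OF A])
    then show "p \<in> alg_A" by (simp add: poly_as_sum_of_monoms)
  qed
qed

lemma finitely_generated_chi: "finitely_generated chi"
proof -
  let ?S = "{monom (var_x + var_y) 1, monom (var_x * var_y) 1, monom (var_x * var_y\<^sup>2) 1,
    monom var_y 2}"
  let ?B = "adjoin scalars (insert (monom 1 1) ?S)"
  have B: "is_subring ?B" by (rule is_subring_adjoin)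
  have sup: "scalars \<subseteq> ?B" "monom 1 1 \<in> ?B" "?S \<subseteq> ?B"
    using adjoin_superset[of scalars "insert (monom 1 1) ?S"] by simp_all
  have A: "is_subring alg_A" by (simp add: alg_A_def is_subring_adjoin)
  have "scalars \<subseteq> scalars_t"
  proof
    fix p assume "p \<in> scalars"
    then obtain c where "p = [:[:[:c:]:]:]" by (auto simp: scalars_def)
    then have "p = map_poly (\<lambda>c. [:[:c:]:]) [:c:]" by (simp add: map_poly_pCons)
    then show "p \<in> scalars_t" by (auto simp: scalars_t_def)
  qed
  moreover have "monom 1 1 \<in> scalars_t"
    unfolding scalars_t_def
    by (rule image_eqI[where x = "monom 1 1"]) (simp_all add: map_poly_monom one_pCons)
  moreover have "scalars_t \<union> ?S \<subseteq> alg_A"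
    unfolding alg_A_def by (rule adjoin_superset)
  ultimately have "?B \<subseteq> alg_A"
    by (intro adjoin_minimal A) (simp, blast)
  moreover have "scalars_t \<subseteq> ?B"
  proof
    fix p assume "p \<in> scalars_t"
    then obtain q where "p = map_poly (\<lambda>c. [:[:c:]:]) q" by (auto simp: scalars_t_def)
    moreover have "map_poly (\<lambda>c. [:[:c:]:]) q \<in> ?B"
    proof (induction q)
      case 0
      show ?case unfolding map_poly_0 by (rule is_subring_simps(2)[OF B])
    next
      case (pCons a q)
      have "map_poly (\<lambda>c. [:[:c:]:]) (pCons a q) =
          [:[:[:a:]:]:] + monom 1 1 * map_poly (\<lambda>c. [:[:c:]:]) q"
        by (simp add: map_poly_pCons monom_altdef)
      moreover have "[:[:[:a:]:]:] \<in> ?B" using sup(1) by (auto simp: scalars_def)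
      ultimately show ?case
        using pCons.IH sup(2) is_subring_simps(3,4)[OF B] by metis
    qed
    ultimately show "p \<in> ?B" by simp
  qed
  then have "alg_A \<subseteq> ?B"
    unfolding alg_A_def by (intro adjoin_minimal Un_least sup(3) B)
  ultimately have "rees chi = ?B" by (simp add: rees_chi)
  then show ?thesis
    unfolding finitely_generated_def by (intro exI[of _ "insert (monom 1 1) ?S"]) simp
qed

end

theory Submission
  imports Defs
begin

text \<open>
  Write \<open>(a, b, i)\<close> for the monomial \<open>x\<^sup>a y\<^sup>b t\<^sup>i\<close>. On forms of a fixed degree the lowest \<open>\<lambda>\<close>-weight term
  is the term of highest degree in \<open>x\<close>, so the limit of \<open>F\<^sub>i R \<inter> R\<^sub>k\<close> is spanned by the \<open>x\<close>-leading
  monomials of its elements (\<open>lim_filtration_lam\<close>), and the Rees algebra of the limit is the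
  initial algebra of \<open>A\<close>. The question becomes whether the semigroup of leading monomials of
  \<open>A\<close> is finitely generated; the example is a graded form of the algebra of Robbiano and Sweedler.

  Infinitely many leading monomials are forced by the identity
  \<open>(x + y) (x y\<^sup>n\<^sup>+\<^sup>1) - (x y) (x y\<^sup>n) = x y\<^sup>n\<^sup>+\<^sup>2\<close>: inductively it puts every \<open>(1, n + 1, n)\<close> with
  \<open>n \<ge> 1\<close> into \<open>A\<close> (\<open>xy_power_in_alg_A\<close>).

  None of these monomials can be assembled from the others, because the exponents in \<open>A\<close> are
  constrained. All terms of the four generators and of \<open>t\<close> satisfy \<open>a \<le> i\<close> and \<open>b \<le> i + a\<close>; and on
  the two edges \<open>(q, 0, q)\<close> and \<open>(0, q, q)\<close> of the region the coefficients agree, since these edge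
  coefficients are multiplicative and come only from powers of \<open>t (x + y)\<close>
  (\<open>alg_A_subset_bounded_alg\<close>). A leading monomial \<open>(0, q, q)\<close> would have to be accompanied by
  the higher term \<open>(q, 0, q)\<close>, so for \<open>q > 0\<close> it does not occur: a leading monomial that is free of
  \<open>x\<close> satisfies \<open>b < i\<close> or is \<open>1\<close>. Now let \<open>(1, n + 1, n)\<close> be a product of two leading
  monomials. One factor is \<open>(1, b, i)\<close> with \<open>b \<le> i + 1\<close>, the other is
  \<open>(0, n + 1 - b, n - i)\<close> with \<open>n + 1 - b \<ge> n - i\<close>; hence the second factor is \<open>1\<close>. Finitely many
  elements of the initial algebra therefore generate only finitely many of these monomials
  (\<open>not_finitely_generated_initial\<close>).
\<close>

section \<open>Leading terms and bases in echelon form\<close>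

lemma homog_coeff_eq_0: "f \<in> homog k \<Longrightarrow> i + j \<noteq> k \<Longrightarrow> coeff (coeff f j) i = 0"
  by (auto simp: homog_def)

lemma subspace_homog: "bipoly.subspace (homog k)"
  by (rule bipoly.subspaceI) (auto simp: homog_def cscale_def, metis add_0)

lemma coeff_cscale [simp]: "coeff (coeff (cscale c p) j) i = c * coeff (coeff p j) i"
  by (simp add: cscale_def)

text \<open>
  \<open>x\<^sup>a y\<^sup>k\<^sup>-\<^sup>a\<close> is the term of lowest \<open>\<lambda>\<close>-weight, its weight being \<open>k - 2 a\<close>.
\<close>

definition has_lead :: "nat \<Rightarrow> bipoly \<Rightarrow> nat \<Rightarrow> bool" where
  "has_lead k f a \<longleftrightarrow> f \<in> homog k \<and> a \<le> k \<and> coeff (coeff f (k - a)) a \<noteq> 0 \<and>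
     (\<forall>i>a. \<forall>j. coeff (coeff f j) i = 0)"

definition lead_exps :: "nat \<Rightarrow> bipoly set \<Rightarrow> nat set" where
  "lead_exps k W = {a. \<exists>f\<in>W. has_lead k f a}"

definition xymono :: "nat \<Rightarrow> nat \<Rightarrow> bipoly" where
  "xymono a b = monom (monom 1 a) b"

definition initial_space :: "nat \<Rightarrow> bipoly set \<Rightarrow> bipoly set" where
  "initial_space k W = bipoly.span ((\<lambda>a. xymono a (k - a)) ` lead_exps k W)"

lemma coeff_xymono: "coeff (coeff (xymono a b) j) i = (if i = a \<and> j = b then 1 else 0)"
  by (auto simp: xymono_def)

lemma finite_lead_exps: "finite (lead_exps k W)"
  by (rule finite_subset[of _ "{..k}"]) (auto simp: lead_exps_def has_lead_def)

lemma has_lead_unique: "has_lead k f a \<Longrightarrow> has_lead k f b \<Longrightarrow> a = b"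
  by (metis has_lead_def linorder_neqE_nat)

lemma has_lead_xymono: "a \<le> k \<Longrightarrow> has_lead k (xymono a (k - a)) a"
  by (auto simp: has_lead_def homog_def coeff_xymono)

lemma has_lead_inj_on:
  assumes "\<And>a. a \<in> J \<Longrightarrow> has_lead k (f a) a"
  shows "inj_on f J"
  using assms has_lead_unique by (metis inj_onI)

text \<open>
  Distinct leading exponents form a triangular system: in a linear relation, compare the coefficients
  at the largest leading exponent that occurs.
\<close>

lemma has_lead_independent:
  assumes "finite J" and lead: "\<And>a. a \<in> J \<Longrightarrow> has_lead k (f a) a"
  shows "bipoly.independent (f ` J)"
proof (rule bipoly.independent_if_scalars_zero)
  show "finite (f ` J)" using assms(1) by simp
  fix u p assume sum: "(\<Sum>p\<in>f ` J. cscale (u p) p) = 0" and "p \<in> f ` J"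
  let ?N = "{a\<in>J. u (f a) \<noteq> 0}"
  have "?N = {}"
  proof (rule ccontr)
    assume ne: "?N \<noteq> {}"
    have fin: "finite ?N" using assms(1) by simp
    define m where "m = Max ?N"
    have m: "m \<in> J" "u (f m) \<noteq> 0" using Max_in[OF fin ne] by (auto simp: m_def)
    have "0 = coeff (coeff (\<Sum>a\<in>J. cscale (u (f a)) (f a)) (k - m)) m"
      using sum by (simp add: sum.reindex[OF has_lead_inj_on[OF lead]])
    also have "\<dots> = (\<Sum>a\<in>J. u (f a) * coeff (coeff (f a) (k - m)) m)"
      by (simp add: coeff_sum)
    also have "\<dots> = (\<Sum>a\<in>J. if a = m then u (f m) * coeff (coeff (f m) (k - m)) m else 0)"
    proof (rule sum.cong[OF refl])
      fix a assume a: "a \<in> J"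
      consider "a = m" | "a < m" | "a > m" by linarith
      then show "u (f a) * coeff (coeff (f a) (k - m)) m =
          (if a = m then u (f m) * coeff (coeff (f m) (k - m)) m else 0)"
      proof cases
        case 2
        then show ?thesis using lead[OF a] by (simp add: has_lead_def)
      next
        case 3
        then have "u (f a) = 0" using Max_ge[OF fin, of a] a by (auto simp: m_def)
        then show ?thesis using 3 by simp
      qed simp
    qed
    also have "\<dots> = u (f m) * coeff (coeff (f m) (k - m)) m"
      using assms(1) m(1) by simp
    finally show False using m lead[OF m(1)] by (simp add: has_lead_def)
  qed
  then show "u p = 0" using \<open>p \<in> f ` J\<close> by blast
qed

text \<open>
  Division with remainder: subtracting a multiple of the appropriate \<open>f a\<close> lowers the leading
  exponent of an element of \<open>W\<close>, and this ends at \<open>0\<close>.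
\<close>

lemma has_lead_span:
  assumes W: "bipoly.subspace W" "W \<subseteq> homog k"
    and f: "\<And>a. a \<in> lead_exps k W \<Longrightarrow> f a \<in> W \<and> has_lead k (f a) a"
  shows "bipoly.span (f ` lead_exps k W) = W"
proof
  show "bipoly.span (f ` lead_exps k W) \<subseteq> W"
    using f W(1) by (intro bipoly.span_minimal) auto
  have "w \<in> bipoly.span (f ` lead_exps k W)"
    if "w \<in> W" "\<And>i j. i \<ge> n \<Longrightarrow> coeff (coeff w j) i = 0" for w n
    using that
  proof (induction n arbitrary: w)
    case 0
    then have "w = 0" by (intro bipoly_eqI) simp
    then show ?case by (simp add: bipoly.span_zero)
  next
    case (Suc n)
    show ?case
    proof (cases "\<exists>j. coeff (coeff w j) n \<noteq> 0")
      case False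
      then have "coeff (coeff w j) i = 0" if "i \<ge> n" for i j
        using Suc.prems(2)[of i j] that by (cases "i = n") auto
      then show ?thesis using Suc.IH Suc.prems(1) by blast
    next
      case True
      then obtain j where j: "coeff (coeff w j) n \<noteq> 0" by blast
      have hw: "w \<in> homog k" using Suc.prems(1) W(2) by blast
      then have "n + j = k" using j by (auto simp: homog_def)
      then have "has_lead k w n"
        using j hw Suc.prems(2) by (auto simp: has_lead_def)
      then have n: "n \<in> lead_exps k W" using Suc.prems(1) by (auto simp: lead_exps_def)
      define c where "c = coeff (coeff w (k - n)) n / coeff (coeff (f n) (k - n)) n"
      let ?w = "w - cscale c (f n)"
      have fn: "f n \<in> W" "has_lead k (f n) n" using f[OF n] by auto
      have "?w \<in> W"
        using W(1) Suc.prems(1) fn by (simp add: bipoly.subspace_diff bipoly.subspace_scale)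
      moreover have "coeff (coeff ?w j) i = 0" if "i \<ge> n" for i j
      proof (cases "i = n")
        case True
        show ?thesis
        proof (cases "j = k - n")
          case jk: True
          then show ?thesis using True fn(2) by (simp add: c_def has_lead_def)
        next
          case False
          have "n \<le> k" using fn(2) by (simp add: has_lead_def)
          with False True have "i + j \<noteq> k" by auto
          then show ?thesis
            using homog_coeff_eq_0[OF hw] homog_coeff_eq_0[of "f n" k] fn(2) by (simp add: has_lead_def)
        qed
      next
        case False
        then show ?thesis using that Suc.prems(2)[of i j] fn(2) by (simp add: has_lead_def)
      qed
      ultimately have "?w \<in> bipoly.span (f ` lead_exps k W)" by (rule Suc.IH)
      moreover have "cscale c (f n) \<in> bipoly.span (f ` lead_exps k W)"
        using n by (intro bipoly.span_scale bipoly.span_base) blast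
      ultimately have "?w + cscale c (f n) \<in> bipoly.span (f ` lead_exps k W)"
        by (rule bipoly.span_add)
      then show ?thesis by simp
    qed
  qed
  moreover have "coeff (coeff w j) i = 0" if "w \<in> W" "i \<ge> Suc k" for w i j
    using that W(2) by (intro homog_coeff_eq_0[of _ k]) auto
  ultimately show "W \<subseteq> bipoly.span (f ` lead_exps k W)" by blast
qed

text \<open>
  The initial space therefore has the same dimension as \<open>W\<close>, as a limit in the Grassmannian must.
\<close>

lemma dim_eq_card_lead_exps:
  assumes W: "bipoly.subspace W" "W \<subseteq> homog k"
  shows "bipoly.dim W = card (lead_exps k W)"
proof -
  have "\<forall>a\<in>lead_exps k W. \<exists>f. f \<in> W \<and> has_lead k f a" by (auto simp: lead_exps_def)
  then obtain f where f: "\<And>a. a \<in> lead_exps k W \<Longrightarrow> f a \<in> W \<and> has_lead k (f a) a" by metis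
  have ind: "bipoly.independent (f ` lead_exps k W)" "inj_on f (lead_exps k W)"
    using has_lead_independent[OF finite_lead_exps] has_lead_inj_on f by blast+
  then show ?thesis
    using has_lead_span[OF W f] bipoly.dim_span_eq_card_independent[OF ind(1)] card_image[OF ind(2)]
    by simp
qed


section \<open>Convergence of forms and open sets of the Grassmannian\<close>

lemma tendsto_imp_limitin_coeff_topology:
  assumes "\<And>i j. ((\<lambda>x. coeff (coeff (f x) j) i) \<longlongrightarrow> coeff (coeff l j) i) F"
  shows "limitin coeff_topology f l F"
proof -
  let ?c = "\<lambda>(p :: bipoly) (i, j). coeff (coeff p j) i"
  have "limitin (product_topology (\<lambda>_. euclidean) UNIV) (\<lambda>x. ?c (f x)) (?c l) F"
    unfolding limitin_componentwise using assms by auto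
  then have *: "((\<lambda>x. ?c (f x)) \<longlongrightarrow> ?c l) F"
    by (simp add: euclidean_product_topology)
  show ?thesis
    unfolding limitin_def coeff_topology_def topspace_pullback_topology openin_pullback_topology
    using topological_tendstoD[OF *] by auto
qed

lemma topspace_coeff_topology [simp]: "topspace coeff_topology = UNIV"
  by (simp add: coeff_topology_def topspace_pullback_topology)

lemma continuous_map_coeff:
  "continuous_map coeff_topology euclidean (\<lambda>p. coeff (coeff p j) i)"
proof -
  have "continuous_map euclidean euclidean (\<lambda>g :: nat \<times> nat \<Rightarrow> complex. g (i, j))"
    unfolding euclidean_product_topology[symmetric] by (rule continuous_map_product_projection) simp
  from continuous_map_pullback[OF this, of UNIV "\<lambda>(p :: bipoly) (i, j). coeff (coeff p j) i"] show ?thesis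
    by (simp add: coeff_topology_def comp_def)
qed

lemma continuous_map_into_coeff_topology:
  assumes "\<And>i j. continuous_map X euclidean (\<lambda>x. coeff (coeff (f x) j) i)"
  shows "continuous_map X coeff_topology f"
  unfolding coeff_topology_def
proof (rule continuous_map_pullback')
  show "continuous_map X euclidean ((\<lambda>(p :: bipoly) (i, j). coeff (coeff p j) i) \<circ> f)"
    unfolding euclidean_product_topology[symmetric] continuous_map_componentwise_UNIV
    using assms by auto
qed auto

lemma topspace_stiefel:
  "topspace (stiefel k d) = {v \<in> extensional {..<d}. v ` {..<d} \<subseteq> homog k \<and> inj_on v {..<d} \<and>
     bipoly.independent (v ` {..<d})}"
  by (auto simp: stiefel_def PiE_def)

text \<open>
  The coefficient vectors of norm \<open>1\<close>. Testing a homogeneous condition on them suffices to test it on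
  the whole span of a frame.
\<close>

lemma compact_unit_sphere:
  fixes d :: nat
  shows "compact_space (subtopology (product_topology (\<lambda>_. subtopology euclidean (cball (0::complex) 1)) {..<d})
     {c. (\<Sum>i<d. norm (c i)) = 1})" (is "compact_space (subtopology ?X ?S)")
proof -
  have cb: "compact_space (subtopology euclidean (cball (0::complex) 1))"
    by (rule compact_space_subtopology) simp
  have X: "compact_space ?X"
    unfolding compact_space_product_topology using cb by blast
  have "continuous_map ?X euclideanreal (\<lambda>c. \<Sum>i<d. norm (c i))"
  proof (intro continuous_map_sum continuous_map_norm finite_lessThan)
    fix i assume "i \<in> {..<d}"
    then have "continuous_map ?X (subtopology euclidean (cball 0 1)) (\<lambda>c. c i)"
      by (rule continuous_map_product_projection)
    then show "continuous_map ?X euclidean (\<lambda>c. c i)"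
      by (rule continuous_map_into_fulltopology)
  qed
  then have "closedin ?X {c \<in> topspace ?X. (\<Sum>i<d. norm (c i)) \<in> {1}}"
    by (rule closedin_continuous_map_preimage) simp
  then have "compactin ?X {c \<in> topspace ?X. (\<Sum>i<d. norm (c i)) \<in> {1}}"
    using X by (simp add: closedin_compact_space)
  then have "compact_space (subtopology ?X {c \<in> topspace ?X. (\<Sum>i<d. norm (c i)) \<in> {1}})"
    by (rule compact_space_subtopology)
  moreover have "subtopology ?X {c \<in> topspace ?X. (\<Sum>i<d. norm (c i)) \<in> {1}} = subtopology ?X ?S"
  proof -
    have "{c \<in> topspace ?X. (\<Sum>i<d. norm (c i)) \<in> {1}} = topspace ?X \<inter> ?S" by blast
    then show ?thesis by (simp only: subtopology_restrict[of ?X ?S])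
  qed
  ultimately show ?thesis by simp
qed

text \<open>
  A frame \<open>v\<close> spans a space outside the set exactly if \<open>h (\<Sum>n. c\<^sub>n v\<^sub>n) \<le> 0\<close> for some \<open>c\<close> in the unit
  sphere. The pairs \<open>(v, c)\<close> with this property form a closed set, and projecting along the compact
  sphere keeps it closed.
\<close>

lemma openin_grassmannian_positive:
  fixes h :: "bipoly \<Rightarrow> real"
  assumes cont: "continuous_map coeff_topology euclideanreal h"
    and scale: "\<And>c p. h (cscale c p) = norm c * h p"
  shows "openin (grassmannian k d) {V \<in> topspace (grassmannian k d). \<forall>p\<in>V. p \<noteq> 0 \<longrightarrow> h p > 0}"
    (is "openin _ ?U")
proof -
  let ?B = "product_topology (\<lambda>_. subtopology euclidean (cball (0::complex) 1)) {..<d}"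
  let ?K = "subtopology ?B {c. (\<Sum>i<d. norm (c i)) = 1}"
  let ?P = "prod_topology (stiefel k d) ?K"
  define g :: "(nat \<Rightarrow> bipoly) \<times> (nat \<Rightarrow> complex) \<Rightarrow> bipoly"
    where "g = (\<lambda>x. \<Sum>n<d. cscale (snd x n) (fst x n))"
  have K: "c \<in> topspace ?K \<longleftrightarrow> c \<in> extensional {..<d} \<and> (\<Sum>n<d. norm (c n)) = 1" for c
  proof -
    have "norm (c n) \<le> 1" if "(\<Sum>n<d. norm (c n)) = 1" "n < d" for n
      using member_le_sum[of n "{..<d}" "\<lambda>n. norm (c n)"] that by simp
    then show ?thesis by (auto simp: PiE_def)
  qed
  have g_cont: "continuous_map ?P coeff_topology g"
  proof (rule continuous_map_into_coeff_topology)
    fix i j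
    have "continuous_map ?P euclidean (\<lambda>x. \<Sum>n<d. snd x n * coeff (coeff (fst x n) j) i)"
    proof (rule continuous_map_sum)
      fix n assume n: "n \<in> {..<d}"
      have "continuous_map (stiefel k d) coeff_topology (\<lambda>v. v n)"
        unfolding stiefel_def
        by (intro continuous_map_from_subtopology continuous_map_product_projection[OF n])
      from continuous_map_compose[OF continuous_map_compose[OF continuous_map_fst this] continuous_map_coeff]
      have 1: "continuous_map ?P euclidean (\<lambda>x. coeff (coeff (fst x n) j) i)"
        by (simp add: comp_def)
      have "continuous_map ?K euclidean (\<lambda>c. c n)"
        by (intro continuous_map_from_subtopology
            continuous_map_into_fulltopology[OF continuous_map_product_projection[OF n]])
      from continuous_map_compose[OF continuous_map_snd this]
      have 2: "continuous_map ?P euclidean (\<lambda>x. snd x n)"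
        by (simp add: comp_def)
      show "continuous_map ?P euclidean (\<lambda>x. snd x n * coeff (coeff (fst x n) j) i)"
        using 1 2 by (simp add: continuous_map_atin tendsto_mult)
    qed simp
    then show "continuous_map ?P euclidean (\<lambda>x. coeff (coeff (g x) j) i)"
      by (simp add: g_def coeff_sum)
  qed
  define C where "C = {x \<in> topspace ?P. h (g x) \<in> {..0}}"
  have "closedin ?P C"
    unfolding C_def using continuous_map_compose[OF g_cont cont]
    by (intro closedin_continuous_map_preimage) (auto simp: comp_def)
  then have closed: "closedin (stiefel k d) (fst ` C)"
    using Abstract_Topological_Spaces.closed_map_fst[OF compact_unit_sphere] by (auto simp: closed_map_def)
  have "{v \<in> topspace (stiefel k d). bipoly.span (v ` {..<d}) \<in> ?U} = topspace (stiefel k d) - fst ` C"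
  proof (intro set_eqI iffI)
    fix v assume v: "v \<in> {v \<in> topspace (stiefel k d). bipoly.span (v ` {..<d}) \<in> ?U}"
    then have fr: "inj_on v {..<d}" "bipoly.independent (v ` {..<d})" by (auto simp: topspace_stiefel)
    have "(v, c) \<notin> C" for c
    proof
      assume C: "(v, c) \<in> C"
      then have c: "(\<Sum>n<d. norm (c n)) = 1" by (simp add: C_def K del: topspace_subtopology)
      have "g (v, c) \<in> bipoly.span (v ` {..<d})"
        unfolding g_def fst_conv snd_conv
        by (intro bipoly.span_sum bipoly.span_scale bipoly.span_base imageI)
      moreover have "g (v, c) \<noteq> 0"
      proof
        assume "g (v, c) = 0"
        then have z: "(\<Sum>p\<in>v ` {..<d}. cscale (c (inv_into {..<d} v p)) p) = 0"
          by (simp add: g_def sum.reindex[OF fr(1)] inv_into_f_f[OF fr(1)])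
        have "c n = 0" if "n < d" for n
          using bipoly.independentD[OF fr(2) _ subset_refl z, of "v n"] that inv_into_f_f[OF fr(1), of n] by simp
        then show False using c by simp
      qed
      ultimately have "h (g (v, c)) > 0" using v by auto
      then show False using C by (simp add: C_def)
    qed
    then show "v \<in> topspace (stiefel k d) - fst ` C" using v by auto
  next
    fix v assume v: "v \<in> topspace (stiefel k d) - fst ` C"
    then have fr: "v ` {..<d} \<subseteq> homog k" "inj_on v {..<d}" "bipoly.independent (v ` {..<d})"
      by (auto simp: topspace_stiefel)
    have "bipoly.span (v ` {..<d}) \<in> topspace (grassmannian k d)"
      using bipoly.span_minimal[OF fr(1) subspace_homog] fr
      by (simp add: topspace_grassmannian bipoly.dim_eq_card_independent card_image)
    moreover have "h p > 0" if p_span: "p \<in> bipoly.span (v ` {..<d})" and p_nz: "p \<noteq> 0" for p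
    proof -
      obtain u where "p = (\<Sum>q\<in>v ` {..<d}. cscale (u q) q)"
        using p_span by (auto simp: bipoly.span_finite)
      then have p: "p = (\<Sum>n<d. cscale (u (v n)) (v n))"
        by (simp add: sum.reindex[OF fr(2)])
      define s where "s = (\<Sum>n<d. norm (u (v n)))"
      have "s \<noteq> 0"
      proof
        assume "s = 0"
        then have "\<forall>n<d. u (v n) = 0" by (simp add: s_def sum_nonneg_eq_0_iff)
        then show False using p p_nz by simp
      qed
      moreover have "s \<ge> 0" by (simp add: s_def sum_nonneg)
      ultimately have s: "s > 0" by simp
      define c where "c = restrict (\<lambda>n. u (v n) / of_real s) {..<d}"
      have "(\<Sum>n<d. norm (c n)) = (\<Sum>n<d. norm (u (v n)) / s)"
        using s by (intro sum.cong) (simp_all add: c_def norm_divide)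
      also have "\<dots> = 1"
        using s by (simp add: s_def flip: sum_divide_distrib)
      finally have "(\<Sum>n<d. norm (c n)) = 1" .
      then have c: "c \<in> topspace ?K" by (simp only: K) (simp add: c_def)
      have "g (v, c) = cscale (1 / of_real s) p"
        unfolding p g_def by (simp add: c_def bipoly.scale_sum_right)
      then have "h (g (v, c)) = h p / s" using s by (simp add: scale norm_divide)
      moreover have "(v, c) \<notin> C" using v by force
      then have "h (g (v, c)) > 0" using v c by (simp add: C_def del: topspace_subtopology)
      ultimately show ?thesis using s by (simp add: zero_less_divide_iff)
    qed
    ultimately show "v \<in> {v \<in> topspace (stiefel k d). bipoly.span (v ` {..<d}) \<in> ?U}"
      using v by simp
  qed
  then show ?thesis
    using openin_diff[OF openin_topspace closed]
    unfolding openin_grassmannian by (auto simp: topspace_grassmannian)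
qed

lemma bipoly_functional:
  assumes L: "bipoly.subspace L" "w \<notin> L"
  obtains \<phi> where "Vector_Spaces.linear cscale (*) \<phi>" "\<And>p. p \<in> L \<Longrightarrow> \<phi> p = 0" "\<phi> w = (1::complex)"
proof -
  interpret vector_space_pair cscale "(*) :: complex \<Rightarrow> complex \<Rightarrow> complex"
    by unfold_locales (simp_all add: algebra_simps)
  obtain B where B: "B \<subseteq> L" "bipoly.independent B" "L \<subseteq> bipoly.span B"
    using bipoly.maximal_independent_subset[of L] by blast
  have span: "bipoly.span B = L"
    using B bipoly.span_minimal[OF B(1) L(1)] by blast
  then have "bipoly.independent (insert w B)"
    using B(2) L(2) bipoly.independent_insert bipoly.span_base by metis
  then obtain \<phi> where \<phi>: "Vector_Spaces.linear cscale (*) \<phi>" "\<forall>p\<in>insert w B. \<phi> p = (if p = w then 1 else 0)"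
    using linear_independent_extend[of "insert w B" "\<lambda>p. if p = w then 1 else 0"] by blast
  interpret \<phi>: Vector_Spaces.linear cscale "(*)" \<phi> by fact
  have "\<phi> b = 0" if "b \<in> B" for b using \<phi>(2) that B(1) L(2) by auto
  then have "\<phi> p = 0" if "p \<in> L" for p
    using \<phi>.eq_0_on_span that unfolding span[symmetric] by blast
  then show thesis using that \<phi> by simp
qed

lemma homog_expansion:
  assumes "p \<in> homog k"
  shows "p = (\<Sum>j\<le>k. cscale (coeff (coeff p j) (k - j)) (xymono (k - j) j))"
proof (rule bipoly_eqI)
  fix i j
  have "coeff (coeff (\<Sum>j\<le>k. cscale (coeff (coeff p j) (k - j)) (xymono (k - j) j)) j) i =
      (\<Sum>j'\<le>k. if j' = j then (if i = k - j then coeff (coeff p j) (k - j) else 0) else 0)"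
    unfolding coeff_sum by (intro sum.cong refl) (auto simp: coeff_xymono)
  also have "\<dots> = (if j \<le> k \<and> i = k - j then coeff (coeff p j) (k - j) else 0)"
    by simp
  also have "\<dots> = coeff (coeff p j) i"
    using homog_coeff_eq_0[OF assms, of i j] by auto
  finally show "coeff (coeff p j) i =
      coeff (coeff (\<Sum>j\<le>k. cscale (coeff (coeff p j) (k - j)) (xymono (k - j) j)) j) i" ..
qed

text \<open>
  Limits in the Grassmannian are unique because a vector outside \<open>L\<close> stays outside all spaces near
  \<open>L\<close>, together with its neighbours. The test function compares a norm \<open>N\<close> with a linear functional
  \<open>\<psi>\<close> that vanishes on \<open>L\<close> and is \<open>1\<close> at \<open>w\<close>: on \<open>L\<close> only the norm survives, and at \<open>w\<close> the
  functional prevails.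
\<close>

lemma grassmannian_separation:
  assumes L: "L \<in> topspace (grassmannian k d)" and w: "w \<in> homog k" "w \<notin> L"
  obtains U h where "openin (grassmannian k d) U" "L \<in> U"
    "continuous_map coeff_topology euclideanreal h" "h w < (0::real)"
    "\<And>V p. V \<in> U \<Longrightarrow> p \<in> V \<Longrightarrow> h p \<ge> 0"
proof -
  have sub: "bipoly.subspace L" "L \<subseteq> homog k" using L by (auto simp: topspace_grassmannian)
  obtain \<phi> where lin: "Vector_Spaces.linear cscale (*) \<phi>" and \<phi>: "\<And>p. p \<in> L \<Longrightarrow> \<phi> p = 0" "\<phi> w = (1::complex)"
    using bipoly_functional[OF sub(1) w(2)] by blast
  interpret \<phi>: Vector_Spaces.linear cscale "(*)" \<phi> by fact
  \<comment> \<open>On forms of degree \<open>k\<close>, \<open>\<psi>\<close> is \<open>\<phi>\<close>; unlike \<open>\<phi>\<close> it involves finitely many coefficients only,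
    which makes it continuous.\<close>
  define N where "N p = (\<Sum>j\<le>k. norm (coeff (coeff p j) (k - j)))" for p :: bipoly
  define \<psi> where "\<psi> p = (\<Sum>j\<le>k. coeff (coeff p j) (k - j) * \<phi> (xymono (k - j) j))" for p :: bipoly
  have \<psi>: "\<psi> p = \<phi> p" if "p \<in> homog k" for p
    by (subst (2) homog_expansion[OF that]) (simp add: \<psi>_def \<phi>.sum \<phi>.scale)
  have N_pos: "N p > 0" if "p \<in> homog k" "p \<noteq> 0" for p
  proof -
    have "N p \<noteq> 0"
    proof
      assume "N p = 0"
      then have "\<forall>j\<le>k. coeff (coeff p j) (k - j) = 0" by (simp add: N_def sum_nonneg_eq_0_iff)
      then show False using homog_expansion[OF that(1)] that(2) by simp
    qed
    then show ?thesis using sum_nonneg[of "{..k}" "\<lambda>j. norm (coeff (coeff p j) (k - j))"]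
      by (simp add: N_def)
  qed
  have "w \<noteq> 0" using w(2) bipoly.subspace_0[OF sub(1)] by blast
  then have Nw: "N w > 0" using N_pos w(1) by blast
  \<comment> \<open>The factor makes the first term equal to \<open>1 / 2\<close> at \<open>w\<close>, below \<open>norm (\<psi> w) = 1\<close>.\<close>
  define h where "h p = N p / (2 * N w) - norm (\<psi> p)" for p
  show thesis
  proof
    have scale: "h (cscale c p) = norm c * h p" for c p
      by (simp add: h_def N_def \<psi>_def norm_mult mult.assoc algebra_simps flip: sum_distrib_left)
    show cont: "continuous_map coeff_topology euclideanreal h"
    proof -
      have "continuous_map coeff_topology euclideanreal
          (\<lambda>p. 1 / (2 * N w) * (\<Sum>j\<le>k. norm (coeff (coeff p j) (k - j))) -
            norm (\<Sum>j\<le>k. coeff (coeff p j) (k - j) * \<phi> (xymono (k - j) j)))"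
        unfolding continuous_map_atin limitin_canonical_iff
        by (intro ballI tendsto_intros) (use continuous_map_coeff in \<open>simp_all add: continuous_map_atin\<close>)
      then show ?thesis by (simp add: h_def[abs_def] N_def \<psi>_def)
    qed
    show "openin (grassmannian k d) {V \<in> topspace (grassmannian k d). \<forall>p\<in>V. p \<noteq> 0 \<longrightarrow> h p > 0}"
      by (rule openin_grassmannian_positive[OF cont scale])
    show "L \<in> {V \<in> topspace (grassmannian k d). \<forall>p\<in>V. p \<noteq> 0 \<longrightarrow> h p > 0}"
    proof -
      have "h p > 0" if "p \<in> L" "p \<noteq> 0" for p
        using that N_pos[of p] Nw sub(2) \<psi>[of p] \<phi>(1)[of p] by (auto simp: h_def)
      then show ?thesis using L by simp
    qed
    show "h w < 0" using Nw \<phi>(2) \<psi>[OF w(1)] by (simp add: h_def)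
    have "h 0 = 0" using scale[of 0 0] by simp
    then show "h p \<ge> 0"
      if "V \<in> {V \<in> topspace (grassmannian k d). \<forall>p\<in>V. p \<noteq> 0 \<longrightarrow> h p > 0}" "p \<in> V" for V p
      using that by (cases "p = 0") (auto intro: less_imp_le)
  qed
qed


section \<open>The limit of a subspace under the one-parameter subgroup\<close>

lemma lam_homog: "f \<in> homog k \<Longrightarrow> lam \<tau> f \<in> homog k"
  by (auto simp: homog_def coeff_lam)

lemma has_lead_lam: "has_lead k f a \<Longrightarrow> \<tau> \<noteq> 0 \<Longrightarrow> has_lead k (lam \<tau> f) a"
  by (auto simp: has_lead_def coeff_lam lam_homog)

lemma has_lead_cscale: "has_lead k f a \<Longrightarrow> c \<noteq> 0 \<Longrightarrow> has_lead k (cscale c f) a"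
  by (auto simp: has_lead_def homog_def)

lemma lam_lam_inverse: "\<tau> \<noteq> 0 \<Longrightarrow> lam (inverse \<tau>) (lam \<tau> p) = p"
  by (rule bipoly_eqI) (simp add: coeff_lam field_simps)

lemma lead_exps_lam:
  assumes "\<tau> \<noteq> 0"
  shows "lead_exps k (lam \<tau> ` W) = lead_exps k W"
proof -
  have "has_lead k f a" if "has_lead k (lam \<tau> f) a" for f a
    using has_lead_lam[OF that, of "inverse \<tau>"] assms by (simp add: lam_lam_inverse)
  then show ?thesis
    using has_lead_lam[OF _ assms] unfolding lead_exps_def by blast
qed

lemma subspace_lam:
  assumes "bipoly.subspace W"
  shows "bipoly.subspace (lam \<tau> ` W)"
proof (rule bipoly.subspaceI)
  have "lam \<tau> 0 = 0" by (rule bipoly_eqI) (simp add: coeff_lam)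
  then show "0 \<in> lam \<tau> ` W" using bipoly.subspace_0[OF assms] by force
  show "p + q \<in> lam \<tau> ` W" if "p \<in> lam \<tau> ` W" "q \<in> lam \<tau> ` W" for p q
    using that bipoly.subspace_add[OF assms] by (auto simp flip: lam_add)
  show "cscale c p \<in> lam \<tau> ` W" if "p \<in> lam \<tau> ` W" for c p
    using that bipoly.subspace_scale[OF assms] by (auto simp flip: lam_cscale)
qed

text \<open>
  The factor cancels the weight of \<open>x\<^sup>a y\<^sup>k\<^sup>-\<^sup>a\<close>, so that the leading term stays put as \<open>\<tau>\<close> varies.
\<close>

definition rescaled_lam :: "nat \<Rightarrow> nat \<Rightarrow> bipoly \<Rightarrow> complex \<Rightarrow> bipoly" where
  "rescaled_lam k a f \<tau> = cscale (\<tau> ^ a * inverse \<tau> ^ (k - a)) (lam \<tau> f)"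

text \<open>
  The term with \<open>x\<close>-exponent \<open>i\<close> is multiplied by \<open>\<tau>\<close> to the power \<open>2 (a - i)\<close>, so all terms but the
  leading one die out.
\<close>

lemma limitin_rescaled_lam:
  assumes lead: "has_lead k f a" and one: "coeff (coeff f (k - a)) a = 1"
  shows "limitin coeff_topology (rescaled_lam k a f) (xymono a (k - a)) (at 0)"
proof (rule tendsto_imp_limitin_coeff_topology)
  fix i j
  let ?c = "coeff (coeff f j) i"
  have eq: "coeff (coeff (rescaled_lam k a f \<tau>) j) i = \<tau> ^ (2 * (a - i)) * ?c" if "\<tau> \<noteq> 0" for \<tau>
  proof (cases "?c = 0")
    case False
    have "i \<le> a" using False lead by (meson has_lead_def not_le_imp_less)
    moreover have "i + j = k" using False lead homog_coeff_eq_0[of f k i j] by (auto simp: has_lead_def)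
    moreover have "a \<le> k" using lead by (simp add: has_lead_def)
    ultimately obtain m where m: "a = i + m" "j = k - a + m"
      by (intro that[of "a - i"]) auto
    have "\<tau> ^ a * inverse \<tau> ^ (k - a) * (inverse \<tau> ^ i * \<tau> ^ j) =
        \<tau> ^ (2 * m) * (\<tau> ^ i * inverse \<tau> ^ i) * (\<tau> ^ (k - a) * inverse \<tau> ^ (k - a))"
      by (simp add: m(2)) (simp add: m(1) power_add mult_2_right mult_ac)
    also have "\<dots> = \<tau> ^ (2 * m)" using that by (simp flip: power_mult_distrib)
    finally have "\<tau> ^ a * inverse \<tau> ^ (k - a) * (inverse \<tau> ^ i * \<tau> ^ j) = \<tau> ^ (2 * (a - i))"
      by (simp add: m(1))
    then show ?thesis by (simp add: rescaled_lam_def coeff_lam flip: mult.assoc)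
  qed (simp add: rescaled_lam_def coeff_lam)
  have "((\<lambda>\<tau>. \<tau> ^ (2 * (a - i)) * ?c) \<longlongrightarrow> 0 ^ (2 * (a - i)) * ?c) (at 0)"
    by (intro tendsto_intros)
  moreover have "0 ^ (2 * (a - i)) * ?c = coeff (coeff (xymono a (k - a)) j) i"
  proof -
    have "?c = 0" if "i > a" using lead that by (simp add: has_lead_def)
    moreover have "?c = 0" if "i = a" "j \<noteq> k - a"
      using homog_coeff_eq_0[of f k i j] lead that by (auto simp: has_lead_def)
    ultimately show ?thesis using one by (cases i a rule: linorder_cases) (auto simp: coeff_xymono)
  qed
  ultimately have "((\<lambda>\<tau>. \<tau> ^ (2 * (a - i)) * ?c) \<longlongrightarrow> coeff (coeff (xymono a (k - a)) j) i) (at 0)"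
    by simp
  then show "((\<lambda>\<tau>. coeff (coeff (rescaled_lam k a f \<tau>) j) i) \<longlongrightarrow> coeff (coeff (xymono a (k - a)) j) i) (at 0)"
    by (rule Lim_transform_eventually) (auto simp: eventually_at_filter eq)
qed

lemma monic_family:
  assumes W: "bipoly.subspace W"
  obtains f where "\<And>a. a \<in> lead_exps k W \<Longrightarrow> f a \<in> W \<and> has_lead k (f a) a \<and> coeff (coeff (f a) (k - a)) a = 1"
proof -
  have "\<exists>f. f \<in> W \<and> has_lead k f a \<and> coeff (coeff f (k - a)) a = 1"
    if a: "a \<in> lead_exps k W" for a
  proof -
    obtain g where g: "g \<in> W" "has_lead k g a" using a by (auto simp: lead_exps_def)
    then have nz: "coeff (coeff g (k - a)) a \<noteq> 0" by (simp add: has_lead_def)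
    let ?f = "cscale (inverse (coeff (coeff g (k - a)) a)) g"
    have "?f \<in> W" "has_lead k ?f a" "coeff (coeff ?f (k - a)) a = 1"
      using g nz bipoly.subspace_scale[OF W] by (auto intro: has_lead_cscale)
    then show ?thesis by blast
  qed
  then show thesis using that by metis
qed

lemma lead_frame:
  assumes e: "bij_betw e {..<d} J" and f: "\<And>a. a \<in> J \<Longrightarrow> has_lead k (f a) a"
  shows "restrict (\<lambda>n. f (e n)) {..<d} \<in> topspace (stiefel k d)"
    and "restrict (\<lambda>n. f (e n)) {..<d} ` {..<d} = f ` J"
proof -
  have J: "e ` {..<d} = J" "inj_on e {..<d}" using e by (auto simp: bij_betw_def)
  then have fin: "finite J" by blast
  have im: "(\<lambda>n. f (e n)) ` {..<d} = f ` J" using J(1) by auto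
  show "restrict (\<lambda>n. f (e n)) {..<d} ` {..<d} = f ` J" using im by simp
  have "inj_on f (e ` {..<d})" using has_lead_inj_on[OF f] J(1) by simp
  then have "inj_on (\<lambda>n. f (e n)) {..<d}"
    using comp_inj_on[OF J(2)] by (simp add: comp_def)
  then have "inj_on (restrict (\<lambda>n. f (e n)) {..<d}) {..<d}" by (simp add: inj_on_restrict_eq)
  moreover have "f ` J \<subseteq> homog k" using f by (auto simp: has_lead_def)
  ultimately show "restrict (\<lambda>n. f (e n)) {..<d} \<in> topspace (stiefel k d)"
    using has_lead_independent[OF fin f] im by (simp add: topspace_stiefel)
qed

lemma rescaled_lam_in_lam_image:
  assumes "bipoly.subspace W" "f \<in> W"
  shows "rescaled_lam k a f \<tau> \<in> lam \<tau> ` W"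
  unfolding rescaled_lam_def using bipoly.subspace_scale[OF subspace_lam[OF assms(1)]] assms(2) by blast

text \<open>
  A basis of \<open>W\<close> in echelon form, moved by \<open>\<lambda>(\<tau>)\<close> and rescaled, is a frame of \<open>\<lambda>(\<tau>) W\<close> which
  converges to the frame of leading monomials. The topology of the Grassmannian is a quotient of that
  of the frames, so convergence of the spans follows.
\<close>

lemma limitin_initial_space:
  assumes W: "bipoly.subspace W" "W \<subseteq> homog k"
  shows "limitin (grassmannian k (bipoly.dim W)) (\<lambda>\<tau>. lam \<tau> ` W) (initial_space k W) (at 0)"
proof -
  define J where "J = lead_exps k W"
  define d where "d = bipoly.dim W"
  have d: "d = card J" using dim_eq_card_lead_exps[OF W] by (simp add: d_def J_def)
  obtain f where f: "\<And>a. a \<in> J \<Longrightarrow> f a \<in> W \<and> has_lead k (f a) a \<and> coeff (coeff (f a) (k - a)) a = 1"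
    using monic_family[OF W(1)] unfolding J_def by blast
  obtain e where e: "bij_betw e {..<d} J"
    using ex_bij_betw_nat_finite[OF finite_lead_exps[of k W]] by (auto simp: d J_def atLeast0LessThan)
  define v where "v \<tau> = restrict (\<lambda>n. rescaled_lam k (e n) (f (e n)) \<tau>) {..<d}" for \<tau>
  define v0 where "v0 = restrict (\<lambda>n. xymono (e n) (k - e n)) {..<d}"
  have lead0: "has_lead k (xymono a (k - a)) a" if "a \<in> J" for a
    using that by (intro has_lead_xymono) (auto simp: J_def lead_exps_def has_lead_def)
  have v0: "v0 \<in> topspace (stiefel k d)" "v0 ` {..<d} = (\<lambda>a. xymono a (k - a)) ` J"
    unfolding v0_def using lead_frame[OF e, of k "\<lambda>a. xymono a (k - a)"] lead0 by auto
  have lead: "has_lead k (rescaled_lam k a (f a) \<tau>) a" if "a \<in> J" "\<tau> \<noteq> 0" for a \<tau>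
    unfolding rescaled_lam_def using that f has_lead_lam by (intro has_lead_cscale) auto
  have v: "v \<tau> \<in> topspace (stiefel k d)" "bipoly.span (v \<tau> ` {..<d}) = lam \<tau> ` W" if "\<tau> \<noteq> 0" for \<tau>
  proof -
    have fr: "v \<tau> \<in> topspace (stiefel k d)" "v \<tau> ` {..<d} = (\<lambda>a. rescaled_lam k a (f a) \<tau>) ` J"
      unfolding v_def using lead_frame[OF e, of k "\<lambda>a. rescaled_lam k a (f a) \<tau>"] lead that by auto
    show "v \<tau> \<in> topspace (stiefel k d)" by (fact fr(1))
    have J: "lead_exps k (lam \<tau> ` W) = J" using lead_exps_lam[OF that] by (simp add: J_def)
    have "bipoly.span ((\<lambda>a. rescaled_lam k a (f a) \<tau>) ` lead_exps k (lam \<tau> ` W)) = lam \<tau> ` W"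
    proof (rule has_lead_span[OF subspace_lam[OF W(1)]])
      show "lam \<tau> ` W \<subseteq> homog k" using W(2) lam_homog by blast
    qed (use J f lead that rescaled_lam_in_lam_image[OF W(1)] in auto)
    then show "bipoly.span (v \<tau> ` {..<d}) = lam \<tau> ` W" by (simp add: J fr(2))
  qed
  have ev: "\<forall>\<^sub>F \<tau> in at 0. \<tau> \<noteq> (0::complex)" by (simp add: eventually_at_filter)
  have lim: "limitin (stiefel k d) v v0 (at 0)"
    unfolding stiefel_def limitin_subtopology limitin_componentwise
  proof (intro conjI ballI)
    let ?S = "{v. v ` {..<d} \<subseteq> homog k \<and> inj_on v {..<d} \<and> bipoly.independent (v ` {..<d})}"
    show "v0 \<in> ?S" "v0 \<in> extensional {..<d}" using v0(1) by (auto simp: topspace_stiefel)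
    show "\<forall>\<^sub>F \<tau> in at 0. v \<tau> \<in> ?S"
      using ev by eventually_elim (use v(1) in \<open>auto simp: topspace_stiefel\<close>)
    show "\<forall>\<^sub>F \<tau> in at 0. v \<tau> \<in> topspace (product_topology (\<lambda>_. coeff_topology) {..<d})"
      by (auto simp: v_def)
    fix n assume n: "n \<in> {..<d}"
    then have "e n \<in> J" using e by (auto simp: bij_betw_def)
    then have "limitin coeff_topology (rescaled_lam k (e n) (f (e n))) (xymono (e n) (k - e n)) (at 0)"
      using f by (intro limitin_rescaled_lam) auto
    then show "limitin coeff_topology (\<lambda>\<tau>. v \<tau> n) (v0 n) (at 0)"
      using n by (simp add: v_def v0_def)
  qed
  have init: "bipoly.span (v0 ` {..<d}) = initial_space k W"
    by (simp add: v0(2) initial_space_def J_def)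
  show ?thesis
    unfolding limitin_def d_def[symmetric]
  proof (intro conjI allI impI)
    show "initial_space k W \<in> topspace (grassmannian k d)"
    proof -
      have fr: "v0 ` {..<d} \<subseteq> homog k" "inj_on v0 {..<d}" "bipoly.independent (v0 ` {..<d})"
        using v0(1) by (auto simp: topspace_stiefel)
      show ?thesis
        unfolding init[symmetric] using bipoly.span_minimal[OF fr(1) subspace_homog] fr
        by (simp add: topspace_grassmannian bipoly.dim_eq_card_independent card_image)
    qed
    fix U assume U: "openin (grassmannian k d) U \<and> initial_space k W \<in> U"
    then have "openin (stiefel k d) {v \<in> topspace (stiefel k d). bipoly.span (v ` {..<d}) \<in> U}"
      by (simp add: openin_grassmannian)
    moreover have "v0 \<in> {v \<in> topspace (stiefel k d). bipoly.span (v ` {..<d}) \<in> U}"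
      using v0(1) U init by simp
    ultimately have "\<forall>\<^sub>F \<tau> in at 0. v \<tau> \<in> {v \<in> topspace (stiefel k d). bipoly.span (v ` {..<d}) \<in> U}"
      using lim by (auto simp: limitin_def)
    with ev show "\<forall>\<^sub>F \<tau> in at 0. lam \<tau> ` W \<in> U"
      by eventually_elim (use v(2) in auto)
  qed
qed

text \<open>
  Each leading monomial is a limit of elements of \<open>\<lambda>(\<tau>) W\<close>, so by separation it belongs to every limit
  \<open>L\<close>. Equality of dimensions does the rest.
\<close>

lemma limitin_initial_space_unique:
  assumes W: "bipoly.subspace W" "W \<subseteq> homog k"
    and lim: "limitin (grassmannian k (bipoly.dim W)) (\<lambda>\<tau>. lam \<tau> ` W) L (at 0)"
  shows "L = initial_space k W"
proof -
  let ?d = "bipoly.dim W"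
  have L: "L \<in> topspace (grassmannian k ?d)" using lim by (simp add: limitin_def)
  then have sub: "bipoly.subspace L" "L \<subseteq> homog k" "bipoly.dim L = ?d"
    by (auto simp: topspace_grassmannian)
  have le: "a \<le> k" if "a \<in> lead_exps k W" for a
    using that by (auto simp: lead_exps_def has_lead_def)
  have mem: "xymono a (k - a) \<in> L" if a: "a \<in> lead_exps k W" for a
  proof (rule ccontr)
    assume "xymono a (k - a) \<notin> L"
    moreover have "xymono a (k - a) \<in> homog k" using has_lead_xymono[OF le[OF a]] by (simp add: has_lead_def)
    ultimately obtain U h where U: "openin (grassmannian k ?d) U" "L \<in> U"
      and h: "continuous_map coeff_topology euclideanreal h" "h (xymono a (k - a)) < (0::real)"
      and nonneg: "\<And>V p. V \<in> U \<Longrightarrow> p \<in> V \<Longrightarrow> h p \<ge> 0"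
      using grassmannian_separation[OF L] by metis
    obtain f where f: "f \<in> W" "has_lead k f a" "coeff (coeff f (k - a)) a = 1"
      using monic_family[OF W(1)] a by metis
    have "((\<lambda>\<tau>. h (rescaled_lam k a f \<tau>)) \<longlongrightarrow> h (xymono a (k - a))) (at 0)"
      using continuous_map_limit[OF h(1) limitin_rescaled_lam[OF f(2,3)]] by (simp add: comp_def)
    then have "\<forall>\<^sub>F \<tau> in at 0. h (rescaled_lam k a f \<tau>) < 0"
      using h(2) by (rule order_tendstoD)
    moreover have "\<forall>\<^sub>F \<tau> in at 0. lam \<tau> ` W \<in> U" using lim U by (auto simp: limitin_def)
    ultimately have "\<forall>\<^sub>F \<tau> in at (0::complex). False"
    proof eventually_elim
      case (elim \<tau>)
      then show False using nonneg[OF elim(2) rescaled_lam_in_lam_image[OF W(1) f(1)], of k a] by simp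
    qed
    then show False by simp
  qed
  then have "lead_exps k W \<subseteq> lead_exps k L"
    using has_lead_xymono[OF le] by (auto simp: lead_exps_def[of k L])
  moreover have "card (lead_exps k W) = card (lead_exps k L)"
    using dim_eq_card_lead_exps[OF W] dim_eq_card_lead_exps[OF sub(1,2)] sub(3) by simp
  ultimately have "lead_exps k W = lead_exps k L"
    by (intro card_subset_eq finite_lead_exps)
  then show ?thesis
    unfolding initial_space_def using has_lead_span[OF sub(1,2), of "\<lambda>a. xymono a (k - a)"] mem has_lead_xymono[OF le]
    by simp
qed

lemma lim_filtration_lam:
  assumes "\<And>k. bipoly.subspace (F i \<inter> homog k)"
  shows "lim_filtration lam F i = bipoly.span (\<Union>k. initial_space k (F i \<inter> homog k))"
proof -
  have "(THE L. limitin (grassmannian k (bipoly.dim (F i \<inter> homog k))) (\<lambda>\<tau>. lam \<tau> ` (F i \<inter> homog k)) L (at 0)) =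
      initial_space k (F i \<inter> homog k)" for k
    by (intro the_equality limitin_initial_space limitin_initial_space_unique assms) auto
  then show ?thesis by (simp add: lim_filtration_def)
qed


section \<open>The exponents that occur in \<open>A\<close>\<close>

lemma coeff3_mult:
  fixes p q :: "bipoly poly"
  shows "coeff (coeff (coeff (p * q) i) b) a =
    (\<Sum>i'\<le>i. \<Sum>b'\<le>b. \<Sum>a'\<le>a. coeff (coeff (coeff p i') b') a' * coeff (coeff (coeff q (i - i')) (b - b')) (a - a'))"
  by (simp add: coeff_mult coeff_sum)

text \<open>
  An upper bound for \<open>A\<close>. The equality of edge coefficients records that \<open>x\<close> and \<open>y\<close> enter with equal
  coefficient through \<open>t (x + y)\<close>, the only generator with a term on either edge:
  \<open>t\<^sup>2 y\<close> carries one \<open>t\<close> too many for the edge of the powers of \<open>y\<close>.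
\<close>

definition bounded_alg :: "bipoly poly set" where
  "bounded_alg = {p. (\<forall>a b i. coeff (coeff (coeff p i) b) a \<noteq> 0 \<longrightarrow> a \<le> i \<and> b \<le> i + a) \<and>
     (\<forall>q. coeff (coeff (coeff p q) 0) q = coeff (coeff (coeff p q) q) 0)}"

text \<open>
  The inequalities are additive in the exponents. If two monomials of the region multiply to one on an
  edge, then both lie on that edge, so an edge coefficient of a product is the convolution of the
  edge coefficients of the factors.
\<close>

lemma is_subring_bounded_alg: "is_subring bounded_alg"
  unfolding is_subring_def
proof (intro conjI ballI)
  show "1 \<in> bounded_alg" by (auto simp: bounded_alg_def coeff_1 split: if_splits)
  fix p q assume p: "p \<in> bounded_alg" and q: "q \<in> bounded_alg"
  let ?c = "\<lambda>(p :: bipoly poly) a b i. coeff (coeff (coeff p i) b) a"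
  have supp: "a \<le> i \<and> b \<le> i + a" if "r \<in> bounded_alg" "?c r a b i \<noteq> 0" for r a b i
    using that by (auto simp: bounded_alg_def)
  have eq: "?c r n 0 n = ?c r 0 n n" if "r \<in> bounded_alg" for r n
    using that by (auto simp: bounded_alg_def)
  show "p - q \<in> bounded_alg"
    unfolding bounded_alg_def
  proof (intro CollectI conjI allI impI)
    fix a b i assume "?c (p - q) a b i \<noteq> 0"
    then have "?c p a b i \<noteq> 0 \<or> ?c q a b i \<noteq> 0" by auto
    then show "a \<le> i" "b \<le> i + a" using supp p q by blast+
  qed (simp add: eq p q)
  show "p * q \<in> bounded_alg"
    unfolding bounded_alg_def
  proof (intro CollectI conjI allI impI)
    fix a b i assume "?c (p * q) a b i \<noteq> 0"
    then obtain i' b' a' where *: "i' \<le> i" "b' \<le> b" "a' \<le> a"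
        "?c p a' b' i' \<noteq> 0" "?c q (a - a') (b - b') (i - i') \<noteq> 0"
      unfolding coeff3_mult by (metis (lifting) atMost_iff mult_eq_0_iff sum.neutral)
    with supp[OF p *(4)] supp[OF q *(5)] show "a \<le> i" "b \<le> i + a" by linarith+
  next
    fix n
    have z1: "?c p a' 0 i' * ?c q (n - a') 0 (n - i') = 0" if "a' \<noteq> i'" "a' \<le> n" "i' \<le> n" for a' i'
      using supp[OF p, where a = a' and b = 0 and i = i'] supp[OF q, where a = "n - a'" and b = 0 and i = "n - i'"] that
      by (cases "i' < a'") auto
    have z2: "?c p 0 b' i' * ?c q 0 (n - b') (n - i') = 0" if "b' \<noteq> i'" "b' \<le> n" "i' \<le> n" for b' i'
      using supp[OF p, where a = 0 and b = b' and i = i'] supp[OF q, where a = 0 and b = "n - b'" and i = "n - i'"] that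
      by (cases "i' < b'") auto
    have "?c (p * q) n 0 n = (\<Sum>i'\<le>n. \<Sum>a'\<le>n. if a' = i' then ?c p i' 0 i' * ?c q (n - i') 0 (n - i') else 0)"
      (is "_ = ?r")
    proof -
      have "?c (p * q) n 0 n = (\<Sum>i'\<le>n. \<Sum>a'\<le>n. ?c p a' 0 i' * ?c q (n - a') 0 (n - i'))"
        unfolding coeff3_mult by simp
      also have "\<dots> = ?r"
        by (intro sum.cong refl) (auto simp: z1)
      finally show ?thesis .
    qed
    also have "\<dots> = (\<Sum>i'\<le>n. \<Sum>b'\<le>n. if b' = i' then ?c p 0 i' i' * ?c q 0 (n - i') (n - i') else 0)"
      by (simp add: eq p q)
    also have "\<dots> = (\<Sum>i'\<le>n. \<Sum>b'\<le>n. ?c p 0 b' i' * ?c q 0 (n - b') (n - i'))"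
      by (intro sum.cong refl) (auto simp: z2)
    also have "\<dots> = ?c (p * q) 0 n n"
      unfolding coeff3_mult by simp
    finally show "?c (p * q) n 0 n = ?c (p * q) 0 n n" .
  qed
qed

lemma var_x_eq_xymono: "var_x = xymono 1 0" and var_y_eq_xymono: "var_y = xymono 0 1"
  by (simp_all add: var_x_def var_y_def xymono_def monom_altdef one_pCons)

lemma xymono_mult: "xymono a b * xymono c d = xymono (a + c) (b + d)"
  by (simp add: xymono_def mult_monom)

lemma alg_A_subset_bounded_alg: "alg_A \<subseteq> bounded_alg"
  unfolding alg_A_def
proof (rule adjoin_minimal[OF _ is_subring_bounded_alg], intro Un_least)
  show "scalars_t \<subseteq> bounded_alg"
    by (auto simp: scalars_t_def bounded_alg_def coeff_map_poly coeff_pCons split: nat.splits)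
  show "{monom (var_x + var_y) 1, monom (var_x * var_y) 1, monom (var_x * var_y\<^sup>2) 1, monom var_y 2}
      \<subseteq> bounded_alg"
    by (auto simp: bounded_alg_def var_x_eq_xymono var_y_eq_xymono xymono_mult power2_eq_square coeff_xymono
        split: if_splits)
qed

lemma is_subring_alg_A: "is_subring alg_A"
  by (simp add: alg_A_def is_subring_adjoin)

lemma t_in_alg_A: "monom 1 1 \<in> alg_A"
proof -
  have "monom 1 1 = map_poly (\<lambda>c. [:[:c:]:]) (monom 1 1)"
    by (simp add: map_poly_monom one_pCons)
  then have "monom 1 1 \<in> scalars_t" by (auto simp: scalars_t_def)
  then show ?thesis unfolding alg_A_def by (rule subsetD[OF adjoin_superset UnI1])
qed

text \<open>
  The second conjunct is \<open>t\<close> times the first conjunct of the step before, except for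
  \<open>n = 0\<close>; multiplied by \<open>t x y\<close> it is what the induction step subtracts.
\<close>

lemma xy_power_in_alg_A: "monom (xymono 1 (n + 2)) (n + 1) \<in> alg_A \<and> monom (xymono 1 (n + 1)) (n + 1) \<in> alg_A"
proof -
  note A = is_subring_simps[OF is_subring_alg_A]
  have gens: "{monom (var_x + var_y) 1, monom (var_x * var_y) 1, monom (var_x * var_y\<^sup>2) 1, monom var_y 2} \<subseteq> alg_A"
    using adjoin_superset unfolding alg_A_def by (rule Un_subset_iff[THEN iffD1, THEN conjunct2])
  have g: "monom (xymono 1 0 + xymono 0 1) 1 \<in> alg_A" "monom (xymono 1 1) 1 \<in> alg_A" "monom (xymono 1 2) 1 \<in> alg_A"
    using gens by (simp_all add: var_x_eq_xymono var_y_eq_xymono xymono_mult power2_eq_square eval_nat_numeral)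
  show ?thesis
  proof (induction n)
    case 0
    show ?case using g(2,3) by (simp add: eval_nat_numeral)
  next
    case (Suc n)
    have "monom (xymono 1 (Suc n + 2)) (Suc n + 1) =
      monom (xymono 1 0 + xymono 0 1) 1 * monom (xymono 1 (n + 2)) (n + 1) - monom (xymono 1 1) 1 * monom (xymono 1 (n + 1)) (n + 1)"
      by (simp add: mult_monom distrib_right xymono_mult diff_monom)
    also have "\<dots> \<in> alg_A" using Suc g by (intro A) auto
    finally have 1: "monom (xymono 1 (Suc n + 2)) (Suc n + 1) \<in> alg_A" .
    have "monom (xymono 1 (Suc n + 1)) (Suc n + 1) = monom 1 1 * monom (xymono 1 (n + 2)) (n + 1)"
      by (simp add: mult_monom)
    also have "\<dots> \<in> alg_A" using Suc t_in_alg_A by (intro A) auto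
    finally show ?case using 1 by simp
  qed
qed

text \<open>
  The last claim is where the edge coefficients matter: for \<open>i > 0\<close>, a form with leading term a multiple of
  \<open>y\<^sup>i\<close> has no term \<open>x\<^sup>i\<close>.
\<close>

lemma lead_exps_chi:
  assumes "a \<in> lead_exps k (chi i \<inter> homog k)"
  shows "k - a \<le> i + a" "a = 0 \<Longrightarrow> k = i \<Longrightarrow> i = 0"
proof -
  obtain f where f: "monom f i \<in> alg_A" "has_lead k f a"
    using assms by (auto simp: lead_exps_def chi_def)
  then have B: "monom f i \<in> bounded_alg" using alg_A_subset_bounded_alg by blast
  have nz: "coeff (coeff f (k - a)) a \<noteq> 0" using f(2) by (simp add: has_lead_def)
  have supp: "c \<le> i + b" if "coeff (coeff f c) b \<noteq> 0" for b c
  proof -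
    have "coeff (coeff (coeff (monom f i) i) c) b \<noteq> 0" using that by simp
    then show ?thesis using B unfolding bounded_alg_def by blast
  qed
  show "k - a \<le> i + a" using supp[OF nz] by auto
  assume "a = 0" "k = i"
  then have "coeff (coeff f 0) i = coeff (coeff f i) 0"
    using B by (auto simp: bounded_alg_def dest: spec[of _ i])
  then show "i = 0" using nz f(2) \<open>a = 0\<close> \<open>k = i\<close> by (auto simp: has_lead_def)
qed

lemma subspace_chi: "bipoly.subspace (chi i \<inter> homog k)"
proof (rule bipoly.subspace_inter[OF _ subspace_homog], rule bipoly.subspaceI)
  note A = is_subring_alg_A
  show "0 \<in> chi i" by (simp add: chi_def is_subring_simps[OF A])
  show "p + q \<in> chi i" if "p \<in> chi i" "q \<in> chi i" for p q
    using that by (simp add: chi_def is_subring_simps[OF A] flip: add_monom)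
  fix c :: complex and p assume p: "p \<in> chi i"
  have "[:[:[:c:]:]:] = map_poly (\<lambda>c. [:[:c:]:]) [:c:]" by (simp add: map_poly_pCons)
  then have "[:[:[:c:]:]:] \<in> scalars_t" by (auto simp: scalars_t_def)
  then have "[:[:[:c:]:]:] \<in> alg_A" unfolding alg_A_def by (rule subsetD[OF adjoin_superset UnI1])
  then have "[:[:[:c:]:]:] * monom p i \<in> alg_A"
    using p by (simp add: chi_def is_subring_simps[OF A] del: mult_pCons_left)
  moreover have "[:[:[:c:]:]:] * monom p i = monom (cscale c p) i"
    by (simp add: smult_monom cscale_def)
  ultimately show "cscale c p \<in> chi i" by (simp add: chi_def)
qed


section \<open>The initial algebra is not finitely generated\<close>

text \<open>
  Finitely many generators have bounded degree in \<open>t\<close>, say below \<open>N\<close>. Because the monomials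
  \<open>x y\<^sup>n\<^sup>+\<^sup>1 t\<^sup>n\<close> are indecomposable, having no such term with \<open>n \<ge> N\<close> is preserved under products, hence
  it passes from the generators to the whole algebra; but \<open>x y\<^sup>N\<^sup>+\<^sup>1 t\<^sup>N\<close> is one of its elements.
\<close>

lemma not_finitely_generated_initial:
  assumes F: "\<And>i. F i = bipoly.span (\<Union>k. initial_space k (chi i \<inter> homog k))"
  shows "\<not> finitely_generated F"
proof
  let ?c = "\<lambda>(p :: bipoly poly) a b i. coeff (coeff (coeff p i) b) a"
  \<comment> \<open>The polynomials supported on a region that contains all leading monomials of \<open>A\<close>.\<close>
  define G where "G = {p :: bipoly poly. \<forall>a b i. ?c p a b i \<noteq> 0 \<longrightarrow> b \<le> i + a \<and> (a = 0 \<longrightarrow> b = i \<longrightarrow> i = 0)}"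
  have Gi: "p \<in> G" if p: "p \<in> rees F" for p
    unfolding G_def
  proof (intro CollectI allI)
    fix a b i
    let ?H = "{f :: bipoly. \<forall>a b. coeff (coeff f b) a \<noteq> 0 \<longrightarrow> b \<le> i + a \<and> (a = 0 \<longrightarrow> b = i \<longrightarrow> i = 0)}"
    have H: "bipoly.subspace ?H"
      by (rule bipoly.subspaceI) (simp, simp, use add_0 in force, simp, blast)
    have "initial_space k (chi i \<inter> homog k) \<subseteq> ?H" for k
      unfolding initial_space_def
    proof (rule bipoly.span_minimal[OF _ H], rule image_subsetI)
      fix a assume a: "a \<in> lead_exps k (chi i \<inter> homog k)"
      then have "a \<le> k" by (auto simp: lead_exps_def has_lead_def)
      then show "xymono a (k - a) \<in> ?H" using lead_exps_chi[OF a] by (auto simp: coeff_xymono)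
    qed
    then have "F i \<subseteq> ?H" unfolding F by (intro bipoly.span_minimal[OF _ H]) blast
    then show "?c p a b i \<noteq> 0 \<longrightarrow> b \<le> i + a \<and> (a = 0 \<longrightarrow> b = i \<longrightarrow> i = 0)"
      using p by (auto simp: rees_def)
  qed
  assume "finitely_generated F"
  then obtain S where S: "finite S" "rees F = adjoin scalars S"
    by (auto simp: finitely_generated_def)
  obtain N where N: "N > 0" "\<And>s n. s \<in> S \<Longrightarrow> n \<ge> N \<Longrightarrow> coeff s n = 0"
  proof
    show "Suc (\<Sum>s\<in>S. degree s) > 0" by simp
    fix s n assume "s \<in> S" "Suc (\<Sum>s\<in>S. degree s) \<le> n"
    then have "degree s < n"
      using member_le_sum[of s S degree] S(1) by simp
    then show "coeff s n = 0" by (rule coeff_eq_0)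
  qed
  define B where "B = {p \<in> G. \<forall>n\<ge>N. ?c p 1 (n + 1) n = 0}"
  have "is_subring B"
    unfolding is_subring_def
  proof (intro conjI ballI)
    show "1 \<in> B" using N(1) by (auto simp: B_def G_def coeff_1 split: if_splits)
    fix p q assume p: "p \<in> B" and q: "q \<in> B"
    have supp: "b \<le> i + a \<and> (a = 0 \<longrightarrow> b = i \<longrightarrow> i = 0)" if "r \<in> B" "?c r a b i \<noteq> 0" for r a b i
      using that by (auto simp: B_def G_def)
    have ze: "?c r 1 (n + 1) n = 0" if "r \<in> B" "n \<ge> N" for r n
      using that by (auto simp: B_def)
    show "p - q \<in> B"
      unfolding B_def G_def
    proof (intro CollectI conjI allI impI)
      fix a b i assume "?c (p - q) a b i \<noteq> 0"
      then have "?c p a b i \<noteq> 0 \<or> ?c q a b i \<noteq> 0" by auto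
      then show "b \<le> i + a" "a = 0 \<Longrightarrow> b = i \<Longrightarrow> i = 0" using supp p q by blast+
    qed (use ze p q in auto)
    have prod: "\<exists>i'\<le>i. \<exists>b'\<le>b. \<exists>a'\<le>a. ?c p a' b' i' \<noteq> 0 \<and> ?c q (a - a') (b - b') (i - i') \<noteq> 0"
      if "?c (p * q) a b i \<noteq> 0" for a b i
      using that unfolding coeff3_mult by (metis (lifting) atMost_iff mult_eq_0_iff sum.neutral)
    show "p * q \<in> B"
      unfolding B_def G_def
    proof (intro CollectI conjI allI impI)
      fix a b i assume "?c (p * q) a b i \<noteq> 0"
      then obtain i' b' a' where *: "i' \<le> i" "b' \<le> b" "a' \<le> a"
          "?c p a' b' i' \<noteq> 0" "?c q (a - a') (b - b') (i - i') \<noteq> 0"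
        using prod by blast
      note s = supp[OF p *(4)] supp[OF q *(5)]
      show "b \<le> i + a" using s * by linarith
      show "i = 0" if "a = 0" "b = i"
      proof -
        have "b' = i'" "b - b' = i - i'" using s * that by auto
        then show ?thesis using s * that by auto
      qed
    next
      fix n assume n: "N \<le> n"
      show "?c (p * q) 1 (n + 1) n = 0"
      proof (rule ccontr)
        assume "?c (p * q) 1 (n + 1) n \<noteq> 0"
        then obtain i' b' a' where *: "i' \<le> n" "b' \<le> n + 1" "a' \<le> 1"
            "?c p a' b' i' \<noteq> 0" "?c q (1 - a') (n + 1 - b') (n - i') \<noteq> 0"
          using prod by blast
        note s = supp[OF p *(4)] supp[OF q *(5)]
        consider "a' = 0" | "a' = 1" using *(3) by linarith
        then show False
        proof cases
          case 1
          \<comment> \<open>The factor free of \<open>x\<close> lies on its edge, so it is the constant term.\<close>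
          then have "b' = i'" using s * by auto
          then have "i' = 0" "b' = 0" using s 1 by auto
          then show False using *(5) 1 ze[OF q n] by simp
        next
          case 2
          then have "n + 1 - b' = n - i'" using s * by auto
          then have "n - i' = 0" "n + 1 - b' = 0" using s 2 by auto
          then have "i' = n" "b' = n + 1" using * by auto
          then show False using *(4) 2 ze[OF p n] by simp
        qed
      qed
    qed
  qed
  moreover have "scalars \<union> S \<subseteq> rees F"
    unfolding S(2) by (rule adjoin_superset)
  then have "scalars \<union> S \<subseteq> B"
    using Gi N by (auto simp: B_def scalars_def coeff_pCons split: nat.splits)
  ultimately have "rees F \<subseteq> B"
    unfolding S(2) by (intro adjoin_minimal)
  moreover have "monom (xymono 1 (N + 1)) N \<in> rees F"
  proof -
    have 0: "0 \<in> F i" for i unfolding F by (rule bipoly.span_zero)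
    have "monom (xymono 1 (N + 1)) N \<in> alg_A"
      using xy_power_in_alg_A[of "N - 1"] N(1) by simp
    then have "xymono 1 (N + 1) \<in> chi N" by (simp add: chi_def)
    moreover have lead: "has_lead (N + 2) (xymono 1 (N + 1)) 1"
      using has_lead_xymono[of 1 "N + 2"] by simp
    ultimately have "1 \<in> lead_exps (N + 2) (chi N \<inter> homog (N + 2))"
      unfolding lead_exps_def by (auto simp: has_lead_def)
    then have "xymono 1 (N + 1) \<in> initial_space (N + 2) (chi N \<inter> homog (N + 2))"
      unfolding initial_space_def by (intro bipoly.span_base) force
    then have "xymono 1 (N + 1) \<in> F N"
      unfolding F by (intro bipoly.span_base) blast
    then show ?thesis using 0 by (auto simp: rees_def)
  qed
  ultimately have "monom (xymono 1 (N + 1)) N \<in> B" by blast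
  then show False by (auto simp: B_def coeff_xymono)
qed

theorem proposition30:
  shows "\<not> finitely_generated (lim_filtration lam chi)"
  using lim_filtration_lam[OF subspace_chi] by (rule not_finitely_generated_initial)

end
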